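(* Let $n$ be a positive integer. The binary structures $\langle\mathbb{R}^{n\times n},\cdot\rangle$ (real $n\times n$ matrices under matrix multiplication) and $\langle\mathcal{P}_n^n,\otimes\rangle$ are isomorphic.
   Context: For a positive integer $n$, $\mathcal{P}_n^n$ denotes the set of polynomials in two variables $x,y$ of the form $P(x,y)=\sum_{k_1=0}^{n-1}\sum_{k_2=0}^{n-1}\lambda_{k_1,k_2}x^{k_1}y^{k_2}$ with $\lambda_{k_1,k_2}\in\mathbb{R}$. The DP product of $P,Q\in\mathcal{P}_n^n$ is $P(x,y)\otimes Q(x,y)=\sum_{k=1}^{n}P(x,k)\,Q(k,y)\in\mathcal{P}_n^n$. Two binary structures $\langle S,*\rangle$ and $\langle S',*'\rangle$ are isomorphic if there is a bijection $\phi:S\to S'$ with $\phi(a*b)=\phi(a)*'\phi(b)$ for all $a,b\in S$. *)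

theory Defs
  imports
    "Jordan_Normal_Form.Matrix"
    "HOL-Computational_Algebra.Polynomial"
begin

definition binary_structure :: "'a set \<Rightarrow> ('a \<Rightarrow> 'a \<Rightarrow> 'a) \<Rightarrow> bool" where
  "binary_structure S f \<longleftrightarrow> (\<forall>a\<in>S. \<forall>b\<in>S. f a b \<in> S)"

definition isomorphic_structures ::
  "'a set \<Rightarrow> ('a \<Rightarrow> 'a \<Rightarrow> 'a) \<Rightarrow> 'b set \<Rightarrow> ('b \<Rightarrow> 'b \<Rightarrow> 'b) \<Rightarrow> bool" where
  "isomorphic_structures S f S' f' \<longleftrightarrow>
     binary_structure S f \<and> binary_structure S' f' \<and>
     (\<exists>\<phi>. bij_betw \<phi> S S' \<and> (\<forall>a\<in>S. \<forall>b\<in>S. \<phi> (f a b) = f' (\<phi> a) (\<phi> b)))"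

text \<open>Polynomials in two variables \<open>x\<close>, \<open>y\<close> are elements of \<open>\<real>[x][y]\<close>: the outer
  variable of a \<open>real poly poly\<close> is \<open>y\<close>, the inner one is \<open>x\<close>, so that
  \<open>\<lambda> x\<^sup>i y\<^sup>j\<close> is \<open>monom (monom \<lambda> i) j\<close>.\<close>

definition dp_polys :: "nat \<Rightarrow> real poly poly set" where
  "dp_polys n = {P. \<exists>c :: nat \<Rightarrow> nat \<Rightarrow> real.
     P = (\<Sum>k\<^sub>1 = 0..n - 1. \<Sum>k\<^sub>2 = 0..n - 1. monom (monom (c k\<^sub>1 k\<^sub>2) k\<^sub>1) k\<^sub>2)}"

text \<open>\<open>P(x, b)\<close>, a polynomial in \<open>x\<close>.\<close>

definition subst_y :: "real poly poly \<Rightarrow> real \<Rightarrow> real poly" where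
  "subst_y P b = poly P [:b:]"

text \<open>\<open>Q(a, y)\<close>, a polynomial in \<open>y\<close>.\<close>

definition subst_x :: "real \<Rightarrow> real poly poly \<Rightarrow> real poly" where
  "subst_x a Q = map_poly (\<lambda>p. poly p a) Q"

text \<open>A product \<open>p(x) q(y)\<close> of univariate polynomials is formed in \<open>\<real>[x][y]\<close> by reading
  \<open>p\<close> as a constant in \<open>y\<close> and lifting the coefficients of \<open>q\<close> to constants in \<open>x\<close>.\<close>

definition dp_product :: "nat \<Rightarrow> real poly poly \<Rightarrow> real poly poly \<Rightarrow> real poly poly" where
  "dp_product n P Q =
     (\<Sum>k = 1..n. [:subst_y P (real k):] * map_poly (\<lambda>c. [:c:]) (subst_x (real k) Q))"

lemma poly_subst_x: "poly (subst_x a Q) b = poly (poly Q [:b:]) a"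
  unfolding subst_x_def by (induction Q) (auto simp: map_poly_pCons)

text \<open>The product has the expected values:
  \<open>(P \<otimes> Q)(a, b) = \<Sum>\<^bsub>k=1..n\<^esub> P(a, k) Q(k, b)\<close>.\<close>

lemma poly_dp_product:
  "poly (poly (dp_product n P Q) [:b:]) a =
     (\<Sum>k = 1..n. poly (poly P [:real k:]) a * poly (poly Q [:b:]) (real k))"
proof -
  have "poly (poly (map_poly (\<lambda>c. [:c:]) q) [:b:]) a = poly q b" for q :: "real poly"
    by (induction q) (auto simp: map_poly_pCons)
  then show ?thesis
    by (simp add: dp_product_def subst_y_def poly_sum poly_subst_x)
qed

end

theory Submission
  imports Defs
begin

text \<open>A real bivariate polynomial of degree less than \<open>n\<close> in each variable is the same thing as
  its table of values on the grid \<open>{1..n} \<times> {1..n}\<close>. Evaluation on this grid,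
  \<open>P \<mapsto> (P(i, j))\<close>, turns the sum \<open>\<Sum>k. P(x, k) Q(k, y)\<close> into the matrix product of the two
  tables by the very definition of that product, so it is multiplicative without any computation;
  the content is that it is bijective (\<open>bij_betw_grid_values\<close>). Injectivity applies
  the bound on the number of roots twice, first to the polynomials \<open>P(x, j)\<close> over \<open>\<real>\<close>, then
  to \<open>P\<close> itself as a polynomial in \<open>y\<close> over the domain \<open>\<real>[x]\<close>
  (\<open>dp_polys_eqI\<close>). Surjectivity is Lagrange interpolation: the
  polynomials \<open>L\<^sub>i(x) L\<^sub>j(y)\<close> have the matrix units as value tables. The isomorphism
  from matrices to polynomials is the inverse of evaluation.\<close>

text \<open>The degree conditions that the explicit double sum encodes; every later argument about
  \<open>dp_polys\<close> goes through them. For \<open>n = 0\<close> the truncated range \<open>{0..n - 1}\<close> would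
  still contain the constant terms, whence the positivity of \<open>n\<close>.\<close>

lemma dp_polys_iff_degree:
  assumes "n > 0"
  shows "P \<in> dp_polys n \<longleftrightarrow> degree P < n \<and> (\<forall>j. degree (coeff P j) < n)"
proof
  assume "P \<in> dp_polys n"
  then obtain c :: "nat \<Rightarrow> nat \<Rightarrow> real"
    where P: "P = (\<Sum>i = 0..n - 1. \<Sum>j = 0..n - 1. monom (monom (c i j) i) j)"
    by (auto simp: dp_polys_def)
  have "degree P < n"
    unfolding P using assms
    by (intro degree_sum_less) (auto intro: le_less_trans[OF degree_monom_le])
  moreover have "degree (coeff P j) < n" for j
    unfolding P coeff_sum using assms
    by (intro degree_sum_less) (auto intro: le_less_trans[OF degree_monom_le])
  ultimately show "degree P < n \<and> (\<forall>j. degree (coeff P j) < n)"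
    by blast
next
  assume deg: "degree P < n \<and> (\<forall>j. degree (coeff P j) < n)"
  then have le: "degree P \<le> n - 1" "degree (coeff P j) \<le> n - 1" for j
    using assms by (metis One_nat_def less_Suc_eq_le Suc_pred)+
  have "P = (\<Sum>j = 0..n - 1. monom (coeff P j) j)"
    using poly_as_sum_of_monoms'[of P "n - 1"] le(1) by (simp add: atMost_atLeast0)
  also have "\<dots> = (\<Sum>j = 0..n - 1. \<Sum>i = 0..n - 1. monom (monom (coeff (coeff P j) i) i) j)"
  proof (rule sum.cong[OF refl])
    fix j
    have "monom (coeff P j) j = monom (\<Sum>i = 0..n - 1. monom (coeff (coeff P j) i) i) j"
      using poly_as_sum_of_monoms'[of "coeff P j" "n - 1"] le(2) by (simp add: atMost_atLeast0)
    also have "\<dots> = (\<Sum>i = 0..n - 1. monom (monom (coeff (coeff P j) i) i) j)"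
      by (rule poly_eqI) (simp add: coeff_sum)
    finally show "monom (coeff P j) j = (\<Sum>i = 0..n - 1. monom (monom (coeff (coeff P j) i) i) j)" .
  qed
  also have "\<dots> = (\<Sum>i = 0..n - 1. \<Sum>j = 0..n - 1. monom (monom (coeff (coeff P j) i) i) j)"
    by (rule sum.swap)
  finally show "P \<in> dp_polys n"
    unfolding dp_polys_def by (intro CollectI exI[of _ "\<lambda>i j. coeff (coeff P j) i"])
qed

lemma dp_polys_sum:
  assumes "n > 0" "\<And>a. a \<in> A \<Longrightarrow> f a \<in> dp_polys n"
  shows "(\<Sum>a\<in>A. f a) \<in> dp_polys n"
  using assms by (auto simp: dp_polys_iff_degree coeff_sum intro!: degree_sum_less)

lemma degree_subst_y:
  assumes "n > 0" "P \<in> dp_polys n"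
  shows "degree (poly P [:b:]) < n"
proof -
  have "degree (coeff P j * [:b:] ^ j) < n" for j
    using assms degree_mult_le[of "coeff P j" "[:b:] ^ j"]
    by (auto simp: dp_polys_iff_degree poly_const_pow)
  then show ?thesis
    unfolding poly_altdef using assms(1) by (intro degree_sum_less)
qed

text \<open>\<open>p(x) q(y)\<close>: the shape of the summands of \<open>dp_product\<close> and of the bivariate
  Lagrange basis.\<close>

definition separated_product :: "real poly \<Rightarrow> real poly \<Rightarrow> real poly poly" where
  "separated_product p q = [:p:] * map_poly (\<lambda>c. [:c:]) q"

lemma poly_separated_product:
  "poly (poly (separated_product p q) [:b:]) a = poly p a * poly q b"
proof -
  have "poly (poly (map_poly (\<lambda>c. [:c:]) q) [:b:]) a = poly q b"
    by (induction q) (auto simp: map_poly_pCons)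
  then show ?thesis
    by (simp add: separated_product_def)
qed

lemma separated_product_in_dp_polys:
  assumes "degree p < n" "degree q < n"
  shows "separated_product p q \<in> dp_polys n"
proof -
  have "coeff (separated_product p q) j = smult (coeff q j) p" for j
    by (simp add: separated_product_def coeff_map_poly mult.commute)
  then have "degree (coeff (separated_product p q) j) < n" for j
    using assms(1) by (metis degree_smult_le le_less_trans)
  moreover have "degree (separated_product p q) \<le> degree q"
    unfolding separated_product_def
    using degree_mult_le[of "[:p:]" "map_poly (\<lambda>c. [:c:]) q"] map_poly_degree_leq[of "\<lambda>c. [:c:]" q]
    by simp
  ultimately show ?thesis
    using assms by (subst dp_polys_iff_degree) auto
qed

lemma dp_product_in_dp_polys:
  assumes n: "n > 0" and P: "P \<in> dp_polys n" and Q: "Q \<in> dp_polys n"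
  shows "dp_product n P Q \<in> dp_polys n"
proof -
  have "degree (subst_x a Q) < n" for a
    using Q n map_poly_degree_leq[of "\<lambda>p. poly p a" Q]
    by (auto simp: subst_x_def dp_polys_iff_degree)
  then show ?thesis
    unfolding dp_product_def subst_y_def separated_product_def[symmetric] using n
    by (intro dp_polys_sum separated_product_in_dp_polys degree_subst_y[OF n P]) auto
qed

definition grid_values :: "nat \<Rightarrow> real poly poly \<Rightarrow> real mat" where
  "grid_values n P = mat n n (\<lambda>(i, j). poly (poly P [:real (Suc j):]) (real (Suc i)))"

text \<open>A nonzero polynomial of degree less than \<open>n\<close> over a domain has fewer than \<open>n\<close>
  roots. Over \<open>\<real>\<close> this makes \<open>P(x, b)\<close> and \<open>Q(x, b)\<close> equal for each node \<open>b\<close>; so, over the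
  domain \<open>\<real>[x]\<close>, the polynomials \<open>P\<close> and \<open>Q\<close> agree at the \<open>n\<close> constants \<open>b\<close>.\<close>

lemma dp_polys_eqI:
  assumes n: "n > 0" and P: "P \<in> dp_polys n" and Q: "Q \<in> dp_polys n"
    and A: "card A = n" and B: "card B = n"
    and eq: "\<And>a b. a \<in> A \<Longrightarrow> b \<in> B \<Longrightarrow> poly (poly P [:b:]) a = poly (poly Q [:b:]) a"
  shows "P = Q"
proof -
  have "poly P [:b:] = poly Q [:b:]" if "b \<in> B" for b
    using eq[OF _ that] degree_subst_y[OF n P] degree_subst_y[OF n Q] A
    by (intro poly_eqI_degree[of A]) auto
  moreover have "card ((\<lambda>b. [:b:]) ` B) = n"
    using B by (subst card_image) (auto simp: inj_on_def)
  ultimately show ?thesis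
    using P Q n by (intro poly_eqI_degree[of "(\<lambda>b. [:b:]) ` B"]) (auto simp: dp_polys_iff_degree)
qed

lemma lagrange_basis_exists:
  fixes A :: "'a::field set"
  assumes "finite A" "a \<in> A"
  obtains L where "degree L < card A"
    and "\<And>x. x \<in> A \<Longrightarrow> poly L x = (if x = a then 1 else 0)"
proof
  define p where "p = (\<Prod>b\<in>A - {a}. [:-b, 1:])"
  have p: "poly p x = (\<Prod>b\<in>A - {a}. x - b)" for x
    by (simp add: p_def poly_prod)
  have "degree p \<le> card (A - {a})"
    unfolding p_def using degree_prod_sum_le[of "A - {a}" "\<lambda>b. [:-b, 1:]"] assms by simp
  also have "card (A - {a}) < card A"
    using assms by (rule card_Diff1_less)
  finally show "degree (smult (inverse (poly p a)) p) < card A"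
    using degree_smult_le le_less_trans by blast
  show "poly (smult (inverse (poly p a)) p) x = (if x = a then 1 else 0)" if "x \<in> A" for x
    using assms that by (auto simp: p)
qed

lemma bij_betw_grid_values:
  assumes n: "n > 0"
  shows "bij_betw (grid_values n) (dp_polys n) (carrier_mat n n)"
  unfolding bij_betw_def
proof
  show "inj_on (grid_values n) (dp_polys n)"
  proof (rule inj_onI)
    fix P Q assume PQ: "P \<in> dp_polys n" "Q \<in> dp_polys n"
      and eq: "grid_values n P = grid_values n Q"
    let ?A = "(\<lambda>i. real (Suc i)) ` {..<n}"
    have "card ?A = n"
      by (subst card_image) (auto simp: inj_on_def)
    moreover have "poly (poly P [:b:]) a = poly (poly Q [:b:]) a" if ab: "a \<in> ?A" "b \<in> ?A" for a b
    proof -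
      from ab obtain i j where ij: "i < n" "j < n" "a = real (Suc i)" "b = real (Suc j)"
        by blast
      then show ?thesis
        using arg_cong[OF eq, of "\<lambda>M. M $$ (i, j)"] by (simp add: grid_values_def)
    qed
    ultimately show "P = Q"
      using dp_polys_eqI[OF n PQ] by blast
  qed
  show "grid_values n ` dp_polys n = carrier_mat n n"
  proof
    show "grid_values n ` dp_polys n \<subseteq> carrier_mat n n"
      by (auto simp: grid_values_def)
    show "carrier_mat n n \<subseteq> grid_values n ` dp_polys n"
    proof
      fix M :: "real mat" assume M: "M \<in> carrier_mat n n"
      let ?A = "(\<lambda>i. real (Suc i)) ` {..<n}"
      have card: "card ?A = n"
        by (subst card_image) (auto simp: inj_on_def)
      have "\<exists>L. degree L < n \<and> (\<forall>k<n. poly L (real (Suc k)) = (if k = i then 1 else 0))"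
        if "i < n" for i
      proof -
        have "finite ?A" "real (Suc i) \<in> ?A"
          using that by auto
        then obtain L where "degree L < card ?A"
          "\<And>x. x \<in> ?A \<Longrightarrow> poly L x = (if x = real (Suc i) then 1 else 0)"
          using lagrange_basis_exists by metis
        then show ?thesis
          using card by (intro exI[of _ L]) auto
      qed
      then obtain L where L: "\<And>i. i < n \<Longrightarrow> degree (L i) < n"
        "\<And>i k. i < n \<Longrightarrow> k < n \<Longrightarrow> poly (L i) (real (Suc k)) = (if k = i then 1 else 0)"
        by metis
      define P where
        "P = (\<Sum>i<n. \<Sum>j<n. separated_product (smult (M $$ (i, j)) (L i)) (L j))"
      have "P \<in> dp_polys n"
        unfolding P_def using L(1) n
        by (intro dp_polys_sum separated_product_in_dp_polys)
           (auto intro: le_less_trans[OF degree_smult_le])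
      moreover have "poly (poly P [:real (Suc l):]) (real (Suc k)) = M $$ (k, l)"
        if kl: "k < n" "l < n" for k l
      proof -
        have "poly (poly P [:real (Suc l):]) (real (Suc k))
            = (\<Sum>i<n. \<Sum>j<n. M $$ (i, j) * poly (L i) (real (Suc k)) * poly (L j) (real (Suc l)))"
          by (simp only: P_def poly_sum poly_separated_product poly_smult)
        also have "\<dots> = (\<Sum>i<n. \<Sum>j<n. if i = k then if j = l then M $$ (i, j) else 0 else 0)"
          using kl by (intro sum.cong refl) (simp add: L(2) del: of_nat_Suc)
        also have "\<dots> = (\<Sum>i<n. if i = k then M $$ (i, l) else 0)"
          using kl by (intro sum.cong refl) simp
        also have "\<dots> = M $$ (k, l)"
          using kl by simp
        finally show ?thesis .
      qed
      then have "grid_values n P = M"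
        using M by (intro eq_matI) (auto simp: grid_values_def)
      ultimately show "M \<in> grid_values n ` dp_polys n"
        by blast
    qed
  qed
qed

lemma grid_values_dp_product:
  "grid_values n (dp_product n P Q) = grid_values n P * grid_values n Q"
proof (rule eq_matI)
  fix i j assume "i < dim_row (grid_values n P * grid_values n Q)"
    and "j < dim_col (grid_values n P * grid_values n Q)"
  then have ij: "i < n" "j < n"
    by (auto simp: grid_values_def)
  \<comment> \<open>Matrix indices start at 0, the nodes at 1.\<close>
  have "(\<Sum>k = 1..n. f k) = (\<Sum>k = 0..<n. f (Suc k))" for f :: "nat \<Rightarrow> real"
    by (simp add: sum.atLeast_Suc_atMost_Suc_shift sum.atLeast1_atMost_eq atLeast0LessThan)
  then show "grid_values n (dp_product n P Q) $$ (i, j)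
      = (grid_values n P * grid_values n Q) $$ (i, j)"
    using ij by (simp add: grid_values_def poly_dp_product scalar_prod_def del: of_nat_Suc)
qed (auto simp: grid_values_def)

theorem theorem4p5:
  fixes n :: nat
  assumes "n > 0"
  shows "isomorphic_structures
    (carrier_mat n n :: real mat set) (*) (dp_polys n) (dp_product n)"
proof -
  let ?\<phi> = "the_inv_into (dp_polys n) (grid_values n)"
  note bij = bij_betw_grid_values[OF assms]
  have inv: "?\<phi> M \<in> dp_polys n" "grid_values n (?\<phi> M) = M" if "M \<in> carrier_mat n n" for M
    using that bij_betwE[OF bij_betw_the_inv_into[OF bij]] f_the_inv_into_f_bij_betw[OF bij]
    by auto
  have "?\<phi> (M * N) = dp_product n (?\<phi> M) (?\<phi> N)"
    if "M \<in> carrier_mat n n" "N \<in> carrier_mat n n" for M N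
    using that assms bij
    by (intro the_inv_into_f_eq)
       (auto simp: bij_betw_def grid_values_dp_product inv dp_product_in_dp_polys)
  then show ?thesis
    unfolding isomorphic_structures_def binary_structure_def
    using bij_betw_the_inv_into[OF bij] dp_product_in_dp_polys[OF assms] by auto
qed

end
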